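(* Let $n\ge 1$ and let $V_1,\dots,V_{\lfloor (n+1)/2\rfloor}$ be the peripheral vertex subsets of $\mathcal{Q}(n)$. Then every vertex $v\in V_j$ has degree $d_v=3(n-1)+2(j-1)$, for $j=1,2,\dots,\lfloor (n+1)/2\rfloor$.
   Context: The $n$-Queens' graph $\mathcal{Q}(n)$ has vertex set $[n]^2$ (squares $(i,j)$ of an $n\times n$ chessboard); two distinct vertices $(i,j),(p,q)$ are adjacent iff $i=p$, or $j=q$, or $i+j=p+q$, or $i-j=p-q$. The peripheral vertex subsets: $V_k$ is the set of squares $(i,j)$ with $\min\{i,j,n+1-i,n+1-j\}=k$, for $k=1,\dots,\lfloor (n+1)/2\rfloor$ (i.e. $V_1$ is the outer ring of the board, $V_2$ the outer ring of the remaining board, and so on). *)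

theory Defs
  imports "Graph_Theory.Pair_Digraph"
begin

text \<open>
  The squares of the board are pairs of integers, so that the differences of coordinates
  below are not truncated. As usual in the library used here, a finite simple
  graph is a finite, loop-free, symmetric relation on its vertices (locale \<open>pair_graph\<close>);
  each edge is thus present as two opposite arcs, and the degree of a vertex is the number
  of arcs leaving it, that is, the number of its neighbours.
\<close>

definition board :: "nat \<Rightarrow> (int \<times> int) set" where
  "board n = {1..int n} \<times> {1..int n}"

definition queen_attacks :: "int \<times> int \<Rightarrow> int \<times> int \<Rightarrow> bool" where
  "queen_attacks u v \<longleftrightarrow>
    (case (u, v) of ((i, j), (p, q)) \<Rightarrow> i = p \<or> j = q \<or> i + j = p + q \<or> i - j = p - q)"

definition queens_graph :: "nat \<Rightarrow> (int \<times> int) pair_pre_digraph" where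
  "queens_graph n =
    \<lparr> pverts = board n,
      parcs = {(u, v). u \<in> board n \<and> v \<in> board n \<and> u \<noteq> v \<and> queen_attacks u v} \<rparr>"

definition peripheral_set :: "nat \<Rightarrow> nat \<Rightarrow> (int \<times> int) set" where
  "peripheral_set n k =
    {(i, j) \<in> pverts (queens_graph n). Min {i, j, int n + 1 - i, int n + 1 - j} = int k}"

lemma pair_graph_queens_graph: "pair_graph (queens_graph n)"
proof -
  have "parcs (queens_graph n) \<subseteq> board n \<times> board n"
    by (auto simp: queens_graph_def)
  moreover have "finite (board n \<times> board n)"
    by (simp add: board_def)
  ultimately have "finite (parcs (queens_graph n))"
    by (rule finite_subset)
  then show ?thesis
    by unfold_locales
      (auto simp: queens_graph_def board_def queen_attacks_def symmetric_def intro!: symI)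
qed

lemma out_degree_queens_graph:
  "out_degree (queens_graph n) v = card {w. (v, w) \<in> parcs (queens_graph n)}"
proof -
  have "out_arcs (queens_graph n) v = Pair v ` {w. (v, w) \<in> parcs (queens_graph n)}"
    by (auto simp: out_arcs_def)
  then show ?thesis
    by (simp add: out_degree_def card_image inj_on_def)
qed

end

(* The four lines through a square (a, b) meet only in (a, b). Apart from that square, row and
   column have n - 1 squares each, and the diagonals n - 1 - |a - b| and
   n - 1 - |a + b - (n + 1)|. The two absolute values add up to
   max |2a - (n + 1)| |2b - (n + 1)| = n + 1 - 2j on the j-th ring. *)
theory Submission
  imports Defs
begin

text \<open>Each line is an injective image of an integer interval, so that its size can be read
  off. The bounds for the diagonals express that both the first coordinate \<open>p\<close> and the
  second one, \<open>p - a + b\<close> or \<open>a + b - p\<close>, lie in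
  \<open>{1..int n}\<close>.\<close>

lemma queens_neighbours:
  assumes "(a, b) \<in> board n"
  shows "{w. ((a, b), w) \<in> parcs (queens_graph n)} =
    Pair a ` ({1..int n} - {b}) \<union> (\<lambda>p. (p, b)) ` ({1..int n} - {a}) \<union>
    ((\<lambda>p. (p, p - a + b)) ` ({max 1 (1 + a - b)..min (int n) (int n + a - b)} - {a}) \<union>
     (\<lambda>p. (p, a + b - p)) ` ({max 1 (a + b - int n)..min (int n) (a + b - 1)} - {a}))"
    (is "?N = ?R \<union> ?C \<union> (?D \<union> ?A)")
proof (rule set_eqI)
  fix w :: "int \<times> int"
  obtain p q where w: "w = (p, q)" by fastforce
  have "w \<in> ?R \<longleftrightarrow> p = a \<and> q \<in> {1..int n} \<and> q \<noteq> b"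
    and "w \<in> ?C \<longleftrightarrow> q = b \<and> p \<in> {1..int n} \<and> p \<noteq> a"
    and "w \<in> ?D \<longleftrightarrow> q = p - a + b \<and> (p, q) \<in> board n \<and> p \<noteq> a"
    and "w \<in> ?A \<longleftrightarrow> q = a + b - p \<and> (p, q) \<in> board n \<and> p \<noteq> a"
    by (auto simp: w board_def image_iff)
  moreover have "w \<in> ?N \<longleftrightarrow> (p, q) \<in> board n \<and> (p \<noteq> a \<or> q \<noteq> b) \<and>
      (a = p \<or> b = q \<or> q = a + b - p \<or> q = p - a + b)"
    using assms by (auto simp: w queens_graph_def queen_attacks_def)
  ultimately show "w \<in> ?N \<longleftrightarrow> w \<in> ?R \<union> ?C \<union> (?D \<union> ?A)"
    using assms unfolding Un_iff board_def mem_Times_iff fst_conv snd_conv by auto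
qed

text \<open>Holds for every square, whatever its ring; stated over \<open>int\<close> to avoid
  truncated subtraction.\<close>

lemma out_degree_queens_graph_eq:
  assumes "(a, b) \<in> board n"
  shows "int (out_degree (queens_graph n) (a, b)) =
    4 * (int n - 1) - \<bar>a - b\<bar> - \<bar>a + b - (int n + 1)\<bar>"
proof -
  have ab: "1 \<le> a" "a \<le> int n" "1 \<le> b" "b \<le> int n"
    using assms by (auto simp: board_def)
  define R where "R = Pair a ` ({1..int n} - {b})"
  define C where "C = (\<lambda>p. (p, b)) ` ({1..int n} - {a})"
  define D where
    "D = (\<lambda>p. (p, p - a + b)) ` ({max 1 (1 + a - b)..min (int n) (int n + a - b)} - {a})"
  define A where
    "A = (\<lambda>p. (p, a + b - p)) ` ({max 1 (a + b - int n)..min (int n) (a + b - 1)} - {a})"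
  \<comment> \<open>By \<open>ab\<close> the removed point lies in each interval, which accounts for
    the -1. For \<open>D\<close>, the interval is \<open>{1 + a - b..int n}\<close> if
    \<open>b \<le> a\<close> and \<open>{1..int n + a - b}\<close> otherwise, of size
    \<open>int n - \<bar>a - b\<bar>\<close>; \<open>A\<close> is similar.\<close>
  have "int (card R) = int n - 1" "int (card C) = int n - 1"
    "int (card D) = int n - 1 - \<bar>a - b\<bar>"
    "int (card A) = int n - 1 - \<bar>a + b - (int n + 1)\<bar>"
    unfolding R_def C_def D_def A_def
    by (subst card_image; use ab in \<open>auto simp: inj_on_def card_Diff_singleton_if\<close>)+
  moreover have "finite R" "finite C" "finite D" "finite A"
    by (auto simp: R_def C_def D_def A_def)
  \<comment> \<open>A square common to two of the sets would have first coordinate \<open>a\<close>,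
    which only \<open>R\<close> allows; for \<open>D\<close> and \<open>A\<close> this follows from
    \<open>2 * p = 2 * a\<close>.\<close>
  moreover have "R \<inter> C = {}" "(R \<union> C) \<inter> (D \<union> A) = {}" "D \<inter> A = {}"
    by (auto simp: R_def C_def D_def A_def)
  ultimately have "int (card (R \<union> C \<union> (D \<union> A))) =
      4 * (int n - 1) - \<bar>a - b\<bar> - \<bar>a + b - (int n + 1)\<bar>"
    by (simp add: card_Un_disjoint)
  then show ?thesis
    unfolding out_degree_queens_graph queens_neighbours[OF assms] R_def C_def D_def A_def .
qed

theorem theorem1:
  fixes n j :: nat and v :: "int \<times> int"
  assumes "n \<ge> 1"
    and "1 \<le> j" and "j \<le> (n + 1) div 2"
    and "v \<in> peripheral_set n j"
  shows "out_degree (queens_graph n) v = 3 * (n - 1) + 2 * (j - 1)"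
proof -
  obtain a b where v: "v = (a, b)" by fastforce
  have ab: "(a, b) \<in> board n" and
    ring: "min a (min b (min (int n + 1 - a) (int n + 1 - b))) = int j"
    using assms(4) by (auto simp: v peripheral_set_def queens_graph_def)
  \<comment> \<open>Put x = 2a - (n + 1) and y = 2b - (n + 1). The left side is (|x - y| + |x + y|)
    / 2 = max |x| |y|, and min a (n + 1 - a) = (n + 1 - |x|) / 2, likewise for b and y.\<close>
  have "\<bar>a - b\<bar> + \<bar>a + b - (int n + 1)\<bar> = int n + 1 - 2 * int j"
    using ring by linarith
  then have "int (out_degree (queens_graph n) v) = 3 * (int n - 1) + 2 * (int j - 1)"
    using out_degree_queens_graph_eq[OF ab] by (simp add: v)
  \<comment> \<open>\<open>n \<ge> 1\<close> and \<open>1 \<le> j\<close> keep the subtractions on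
    \<open>nat\<close> from truncating.\<close>
  also have "\<dots> = int (3 * (n - 1) + 2 * (j - 1))"
    using assms(1,2) by (simp add: of_nat_diff)
  finally show ?thesis
    by (rule of_nat_eq_iff[THEN iffD1])
qed

end
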